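(* Let $X$ be a surjective shift space (i.e. $\sigma(X)=X$). Then $X$ has the average shadowing property if and only if $X$ has the $\bar d$-shadowing property.
   Context: $\mathbb{N}_0=\{0,1,2,\ldots\}$, $\mathbb{N}=\{1,2,\ldots\}$. Let $\mathscr{A}=\{0,1\}$ and let $\mathscr{A}^\infty$ be the set of all sequences $x=\{x_n\}_{n=0}^\infty$ over $\mathscr{A}$, with the product topology and the metric $\rho(x,y)=0$ if $x=y$ and $\rho(x,y)=2^{-\min\{n: x_n\ne y_n\}}$ otherwise. The shift map is $\sigma(x)=\{x_{n+1}\}_{n=0}^\infty$. A shift space is a nonempty, closed, $\sigma$-invariant set $X\subseteq\mathscr{A}^\infty$, viewed as the topological dynamical system $(X,\sigma)$. Its language $\mathcal{L}(X)$ is the set of finite words $w$ over $\mathscr{A}$ such that some $x\in X$ begins with $w$; $|w|$ denotes the length of $w$. For $x,y\in\mathscr{A}^\infty$ let $\bar d(x,y)=\limsup_{n\to\infty}\frac1n|\{i\in[0,n): x_i\ne y_i\}|$. $\bar d$-shadowing property: for every $\varepsilon>0$ there is $N\in\mathbb{N}$ such that for every sequence $\{w^{(i)}\}_{i=1}^\infty\subset\mathcal{L}(X)$ with $|w^{(i)}|\ge N$ for all $i$ there is $x\in X$ with $\bar d(x,w)<\varepsilon$, where $w=w^{(1)}w^{(2)}\ldots\in\mathscr{A}^\infty$ is the infinite concatenation (which need not belong to $X$). $\delta$-average pseudo-orbit in $X$: a sequence $\underline{x}=\{x^{(n)}\}_{n=0}^\infty$ of points of $X$ for which there is $N\in\mathbb{N}$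 such that for all $n\ge N$ and $k\in\mathbb{N}_0$, $\frac1n\sum_{i=0}^{n-1}\rho(\sigma(x^{(i+k)}),x^{(i+k+1)})<\delta$. Average shadowing property: for every $\varepsilon>0$ there is $\delta>0$ such that for every $\delta$-average pseudo-orbit $\underline{x}$ in $X$ there is $z\in X$ with $\limsup_{n\to\infty}\frac1n\sum_{i=0}^{n-1}\rho(\sigma^i(z),x^{(i)})<\varepsilon$. *)

theory Defs
  imports "HOL-Analysis.Analysis"
begin

text \<open>The alphabet \<open>{0,1}\<close> is rendered as \<^typ>\<open>bool\<close>. The library topology on
  \<^typ>\<open>nat \<Rightarrow> bool\<close> is the product of the discrete topologies, so \<^const>\<open>closed\<close> below is
  closedness in the product topology, which is also the topology of \<open>rho\<close>.\<close>

type_synonym bseq = "nat \<Rightarrow> bool"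

definition rho :: "bseq \<Rightarrow> bseq \<Rightarrow> real" where
  "rho x y = (if x = y then 0 else (1/2) ^ (LEAST n. x n \<noteq> y n))"

definition shift :: "bseq \<Rightarrow> bseq" where
  "shift x = (\<lambda>n. x (Suc n))"

definition shift_space :: "bseq set \<Rightarrow> bool" where
  "shift_space X \<longleftrightarrow> X \<noteq> {} \<and> closed X \<and> shift ` X \<subseteq> X"

definition language :: "bseq set \<Rightarrow> bool list set" where
  "language X = {w. \<exists>x\<in>X. \<forall>i<length w. x i = w ! i}"

definition dbar :: "bseq \<Rightarrow> bseq \<Rightarrow> ereal" where
  "dbar x y = limsup (\<lambda>n. ereal (1 / real n * real (card {i. i < n \<and> x i \<noteq> y i})))"

text \<open>Infinite concatenation \<open>w 0 @ w 1 @ w 2 @ \<dots>\<close>. It is meaningful when all words are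
  nonempty: then the first \<open>n + 1\<close> words together have length at least \<open>n + 1\<close>, so they
  determine the letter at position \<open>n\<close>.\<close>

definition inf_concat :: "(nat \<Rightarrow> bool list) \<Rightarrow> bseq" where
  "inf_concat w = (\<lambda>n. concat (map w [0..<Suc n]) ! n)"

definition dbar_shadowing :: "bseq set \<Rightarrow> bool" where
  "dbar_shadowing X \<longleftrightarrow>
     (\<forall>\<epsilon>>0. \<exists>N\<ge>1. \<forall>w :: nat \<Rightarrow> bool list.
        (\<forall>i. w i \<in> language X \<and> length (w i) \<ge> N) \<longrightarrow>
        (\<exists>x\<in>X. dbar x (inf_concat w) < ereal \<epsilon>))"

definition average_pseudo_orbit :: "bseq set \<Rightarrow> real \<Rightarrow> (nat \<Rightarrow> bseq) \<Rightarrow> bool" where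
  "average_pseudo_orbit X \<delta> xs \<longleftrightarrow>
     (\<forall>n. xs n \<in> X) \<and>
     (\<exists>N\<ge>1. \<forall>n\<ge>N. \<forall>k.
        1 / real n * (\<Sum>i<n. rho (shift (xs (i + k))) (xs (i + k + 1))) < \<delta>)"

definition average_shadowing :: "bseq set \<Rightarrow> bool" where
  "average_shadowing X \<longleftrightarrow>
     (\<forall>\<epsilon>>0. \<exists>\<delta>>0. \<forall>xs. average_pseudo_orbit X \<delta> xs \<longrightarrow>
        (\<exists>z\<in>X. limsup (\<lambda>n. ereal (1 / real n * (\<Sum>i<n. rho ((shift ^^ i) z) (xs i)))) < ereal \<epsilon>))"

end

theory Submission
  imports Defs
begin

text \<open>Average shadowing gives d-bar shadowing: following orbits of points of \<open>X\<close> that start with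
  the words \<open>w k\<close>, with jumps only at the word boundaries, is an average pseudo-orbit when the
  words are long, and \<open>rho\<close> of two points is \<open>1\<close> as soon as their first letters differ.

  Conversely, let \<open>M\<close> be large and cut time into blocks of length \<open>M\<close>. In each block take the
  word of length \<open>M\<close> read off the point of the pseudo-orbit at the start of the block. By Markov's
  inequality, jumps of size at least \<open>2\<^sup>-\<^sup>M\<close> are rare if \<open>\<delta>\<close> is small compared with \<open>2\<^sup>-\<^sup>M\<close>, and in
  the absence of such jumps nearby points of the pseudo-orbit are shifts of one another up to \<open>M\<close>
  letters. Hence a point that d-bar shadows the concatenated words shadows the pseudo-orbit on
  average.\<close>

section \<open>Estimates for the metric and for iterates of the shift\<close>

lemma rho_self [simp]: "rho x x = 0"
  by (simp add: rho_def)

lemma rho_nonneg: "0 \<le> rho x y"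
  by (simp add: rho_def)

lemma rho_le_power:
  assumes "\<And>j. j < m \<Longrightarrow> x j = y j"
  shows "rho x y \<le> (1/2) ^ m"
proof (cases "x = y")
  case False
  then obtain n where "x n \<noteq> y n" by blast
  then have "x (LEAST n. x n \<noteq> y n) \<noteq> y (LEAST n. x n \<noteq> y n)"
    by (rule LeastI)
  then have "m \<le> (LEAST n. x n \<noteq> y n)"
    using assms not_le by blast
  then show ?thesis
    using False by (auto simp: rho_def intro: power_decreasing)
qed simp

lemma rho_le_1: "rho x y \<le> 1"
  using rho_le_power[of 0 x y] by simp

text \<open>Used with \<open>m = 0\<close> (different first letters force distance 1) and,
  contrapositively, with \<open>m = M\<close>: a distance below 2^-M means agreement at all
  positions up to and including \<open>M\<close>.\<close>

lemma rho_ge_power: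
  assumes "x j \<noteq> y j" "j \<le> m"
  shows "(1/2) ^ m \<le> rho x y"
proof -
  have "(LEAST n. x n \<noteq> y n) \<le> j"
    using assms(1) by (rule Least_le)
  then show ?thesis
    using assms by (auto simp: rho_def intro: power_decreasing)
qed

lemma shift_funpow: "(shift ^^ i) x = (\<lambda>j. x (i + j))"
  by (induction i) (auto simp: shift_def)

lemma shift_funpow_mem:
  assumes "shift ` X \<subseteq> X" "x \<in> X"
  shows "(shift ^^ i) x \<in> X"
  using assms by (induction i) auto

section \<open>From average shadowing to d-bar shadowing\<close>

lemma le_sum_lessThan:
  fixes l :: "nat \<Rightarrow> nat"
  assumes "\<And>i. 1 \<le> l i"
  shows "k \<le> sum l {..<k}"
  using sum_mono[of "{..<k}" "\<lambda>_. 1" l] assms by simp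

text \<open>Letter \<open>n\<close> is read from words 0 to \<open>n\<close>. Since no word is
  empty, \<open>k\<close> words have total length at least \<open>k\<close>, so
  \<open>k \<le> n\<close> and word \<open>k\<close> is among those joined.\<close>

lemma inf_concat_nth:
  assumes "\<And>i. w i \<noteq> []" "j < length (w k)"
  shows "inf_concat w ((\<Sum>i<k. length (w i)) + j) = w k ! j"
proof -
  define n where "n = (\<Sum>i<k. length (w i)) + j"
  have "k \<le> (\<Sum>i<k. length (w i))"
    using assms(1) by (intro le_sum_lessThan) (simp add: Suc_le_eq)
  then have "k \<le> n" by (simp add: n_def)
  then have "[0..<Suc n] = [0..<k] @ k # [Suc k..<Suc n]"
    by (metis le_imp_less_Suc upt_add_eq_append upt_conv_Cons le_add_diff_inverse zero_le
        less_imp_le_nat)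
  moreover have "length (concat (map w [0..<k])) = (\<Sum>i<k. length (w i))"
    by (simp add: length_concat comp_def interv_sum_list_conv_sum_set_nat atLeast0LessThan)
  ultimately have "concat (map w [0..<Suc n]) ! n = w k ! j"
    using assms(2) by (simp add: nth_append n_def)
  then show ?thesis by (simp add: inf_concat_def n_def)
qed

text \<open>Points at least \<open>N\<close> apart have different quotients by \<open>N\<close>. The
  bound is uniform in the offset \<open>k\<close>, as the definition of a pseudo-orbit
  demands.\<close>

lemma card_separated_le:
  fixes A :: "nat set"
  assumes "\<And>a b. a \<in> A \<Longrightarrow> b \<in> A \<Longrightarrow> a < b \<Longrightarrow> a + N \<le> b" "0 < N"
  shows "card {i. i < n \<and> i + k \<in> A} \<le> n div N + 1"
proof -
  have "inj_on (\<lambda>i. i div N) {i. i < n \<and> i + k \<in> A}"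
  proof (rule linorder_inj_onI)
    fix a b assume "a < b" "a \<in> {i. i < n \<and> i + k \<in> A}" "b \<in> {i. i < n \<and> i + k \<in> A}"
    then have "a + N \<le> b" using assms(1)[of "a + k" "b + k"] by auto
    then have "a div N + 1 \<le> b div N"
      using div_le_mono[of "a + N" b N] assms(2) by simp
    then show "a div N \<noteq> b div N" by simp
  qed auto
  moreover have "(\<lambda>i. i div N) ` {i. i < n \<and> i + k \<in> A} \<subseteq> {..n div N}"
    by (auto intro: div_le_mono)
  ultimately have "card {i. i < n \<and> i + k \<in> A} \<le> card {..n div N}"
    by (intro card_inj_on_le) auto
  then show ?thesis by simp
qed

text \<open>The first \<open>k\<close> with \<open>n < s k\<close> is not 0 because
  \<open>s 0 = 0\<close>; its predecessor is the required index.\<close>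

lemma exists_block:
  fixes s :: "nat \<Rightarrow> nat"
  assumes "s 0 = 0" "\<And>k. k \<le> s k"
  shows "\<exists>k. s k \<le> n \<and> n < s (Suc k)"
proof -
  have "n < s (Suc n)" using assms(2)[of "Suc n"] by simp
  then obtain k where "n < s k" "\<And>i. i < k \<Longrightarrow> \<not> n < s i"
    using exists_least_iff[of "\<lambda>k. n < s k"] by blast
  then show ?thesis using assms(1) by (cases k) (auto simp: not_less)
qed

lemma average_shadowing_imp_dbar_shadowing:
  assumes "shift ` X \<subseteq> X" "average_shadowing X"
  shows "dbar_shadowing X"
  unfolding dbar_shadowing_def
proof (intro allI impI)
  fix \<epsilon> :: real assume "\<epsilon> > 0"
  with assms(2) obtain \<delta> where "\<delta> > 0" and shadow:
    "\<And>xs. average_pseudo_orbit X \<delta> xs \<Longrightarrow>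
      \<exists>z\<in>X. limsup (\<lambda>n. ereal (1 / real n * (\<Sum>i<n. rho ((shift ^^ i) z) (xs i)))) < ereal \<epsilon>"
    unfolding average_shadowing_def by blast
  \<comment> \<open>Two errors of at most 1/N will arise: the density of word boundaries, and one
    extra boundary divided by the window length \<open>n \<ge> N\<close>.\<close>
  obtain N :: nat where N: "2 / \<delta> < real N"
    using reals_Archimedean2 by blast
  have "0 < 2 / \<delta>" using \<open>\<delta> > 0\<close> by simp
  with N have "0 < N" by linarith
  have "\<exists>x\<in>X. dbar x (inf_concat w) < ereal \<epsilon>"
    if w: "\<forall>i. w i \<in> language X \<and> length (w i) \<ge> N" for w
  proof -
    obtain p where p: "\<And>i. p i \<in> X" "\<And>i j. j < length (w i) \<Longrightarrow> p i j = w i ! j"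
      using w unfolding language_def by (auto, metis)
    define s where "s k = (\<Sum>i<k. length (w i))" for k
    have ne: "w i \<noteq> []" for i
      using w \<open>0 < N\<close> by (metis le_zero_eq list.size(3) neq0_conv)
    have s_Suc: "s (Suc k) = s k + length (w k)" for k
      by (simp add: s_def)
    have s_le: "s a \<le> s b" if "a \<le> b" for a b
      using that by (simp add: s_def sum_mono2)
    have s_gap: "s a + N \<le> s b" if "a < b" for a b
      using s_le[of "Suc a" b] that w s_Suc[of a] by (metis Suc_leI add_left_mono le_trans)
    have "k \<le> s k" for k
      unfolding s_def using ne by (intro le_sum_lessThan) (simp add: Suc_le_eq)
    \<comment> \<open>\<open>K n\<close> is the index of the word that covers position
      \<open>n\<close>.\<close>
    then obtain K where K: "\<And>n. s (K n) \<le> n" "\<And>n. n < s (Suc (K n))"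
      using exists_block[of s] by (metis s_def lessThan_0 sum.empty)
    have K_eq: "K n = k" if "s k \<le> n" "n < s (Suc k)" for n k
    proof (rule antisym)
      show "K n \<le> k"
        using s_le[of "Suc k" "K n"] K(1)[of n] that(2) by (meson le_trans not_less_eq_eq not_le)
      show "k \<le> K n"
        using s_le[of "Suc (K n)" k] K(2)[of n] that(1) by (meson le_trans not_less_eq_eq not_le)
    qed
    \<comment> \<open>Inside word \<open>K n\<close> this runs along the true orbit of
      \<open>p (K n)\<close>, so its first letters spell the concatenation and only times
      \<open>n\<close> with \<open>Suc n\<close> a word start can carry an error.\<close>
    define xs where "xs n = (shift ^^ (n - s (K n))) (p (K n))" for n
    have xs_mem: "xs n \<in> X" for n
      unfolding xs_def by (intro shift_funpow_mem assms(1) p(1))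
    have xs_0: "xs n 0 = inf_concat w n" for n
    proof -
      have less: "n - s (K n) < length (w (K n))"
        using K(1)[of n] K(2)[of n] s_Suc[of "K n"] by linarith
      then have "inf_concat w (s (K n) + (n - s (K n))) = w (K n) ! (n - s (K n))"
        unfolding s_def using ne by (intro inf_concat_nth)
      then show ?thesis
        using K(1)[of n] p(2)[OF less] by (simp add: xs_def shift_funpow)
    qed
    have no_jump: "shift (xs n) = xs (Suc n)" if "Suc n \<notin> range s" for n
    proof -
      have "Suc n \<noteq> s (Suc (K n))" using that by blast
      then have "K (Suc n) = K n"
        using K[of n] by (intro K_eq) auto
      then show ?thesis
        using K(1)[of n] by (simp add: xs_def shift_funpow shift_def Suc_diff_le)
    qed
    have "1 / real n * (\<Sum>i<n. rho (shift (xs (i + k))) (xs (i + k + 1))) < \<delta>" if "N \<le> n" for n k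
    proof -
      have "n > 0" using that \<open>0 < N\<close> by simp
      have "(\<Sum>i<n. rho (shift (xs (i + k))) (xs (i + k + 1)))
          \<le> (\<Sum>i<n. of_bool (i + (k + 1) \<in> range s))"
        using no_jump by (intro sum_mono) (auto simp: rho_le_1)
      also have "\<dots> = real (card {i. i < n \<and> i + (k + 1) \<in> range s})"
        by (simp add: lessThan_def Collect_conj_eq)
      also have "\<dots> \<le> real (n div N + 1)"
      proof (rule of_nat_mono, rule card_separated_le[OF _ \<open>0 < N\<close>])
        fix a b assume "a \<in> range s" "b \<in> range s" "a < b"
        then show "a + N \<le> b" using s_gap s_le by (metis imageE not_le)
      qed
      also have "\<dots> \<le> real n / N + 1"
        using of_nat_div_le_of_nat[of n N, where ?'a = real] by simp
      finally have "1 / real n * (\<Sum>i<n. rho (shift (xs (i + k))) (xs (i + k + 1)))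
          \<le> 1 / real n * (real n / N + 1)"
        by (intro mult_left_mono) auto
      also have "\<dots> = 1 / N + 1 / n"
        using \<open>n > 0\<close> by (simp add: field_simps)
      also have "\<dots> \<le> 1 / N + 1 / N"
        using that \<open>0 < N\<close> by (intro add_left_mono) (simp add: frac_le)
      also have "\<dots> < \<delta>"
        using N \<open>0 < N\<close> \<open>\<delta> > 0\<close> by (simp add: field_simps)
      finally show ?thesis .
    qed
    then have "average_pseudo_orbit X \<delta> xs"
      unfolding average_pseudo_orbit_def using xs_mem \<open>0 < N\<close>
      by (intro conjI allI exI[of _ N] impI) auto
    from shadow[OF this] obtain z where "z \<in> X" and z:
      "limsup (\<lambda>n. ereal (1 / real n * (\<Sum>i<n. rho ((shift ^^ i) z) (xs i)))) < ereal \<epsilon>"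
      by blast
    have "1 / real n * real (card {i. i < n \<and> z i \<noteq> inf_concat w i})
        \<le> 1 / real n * (\<Sum>i<n. rho ((shift ^^ i) z) (xs i))" for n
    proof (rule mult_left_mono)
      have "real (card {i. i < n \<and> z i \<noteq> inf_concat w i})
          = (\<Sum>i<n. of_bool (z i \<noteq> inf_concat w i))"
        by (simp add: lessThan_def Collect_conj_eq)
      also have "\<dots> \<le> (\<Sum>i<n. rho ((shift ^^ i) z) (xs i))"
      proof (rule sum_mono)
        fix i
        show "of_bool (z i \<noteq> inf_concat w i) \<le> rho ((shift ^^ i) z) (xs i)"
          using rho_ge_power[of "(shift ^^ i) z" 0 "xs i" 0] rho_nonneg
          by (auto simp: shift_funpow xs_0)
      qed
      finally show "real (card {i. i < n \<and> z i \<noteq> inf_concat w i})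
          \<le> (\<Sum>i<n. rho ((shift ^^ i) z) (xs i))" .
    qed simp
    then have "dbar z (inf_concat w)
        \<le> limsup (\<lambda>n. ereal (1 / real n * (\<Sum>i<n. rho ((shift ^^ i) z) (xs i))))"
      unfolding dbar_def by (intro Limsup_mono always_eventually allI) (simp only: ereal_less_eq)
    with z \<open>z \<in> X\<close> show ?thesis by (meson le_less_trans)
  qed
  then show "\<exists>N\<ge>1. \<forall>w. (\<forall>i. w i \<in> language X \<and> length (w i) \<ge> N) \<longrightarrow>
      (\<exists>x\<in>X. dbar x (inf_concat w) < ereal \<epsilon>)"
    using \<open>0 < N\<close> by (intro exI[of _ N]) auto
qed

section \<open>From d-bar shadowing to average shadowing\<close>

lemma card_window_le:
  "card {i. i < n \<and> (\<exists>j<m. P (i + j))} \<le> m * (card {i. i < n \<and> P i} + m)" for m n :: nat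
proof -
  have "card {i. i < n \<and> P (i + j)} \<le> card {i. i < n \<and> P i} + m" if "j < m" for j
  proof -
    \<comment> \<open>Translation by \<open>j < m\<close> can leave \<open>[0,n)\<close> only into
      the next \<open>m\<close> positions; this is the boundary term \<open>m\<close>.\<close>
    have "(\<lambda>i. i + j) ` {i. i < n \<and> P (i + j)} \<subseteq> {i. i < n \<and> P i} \<union> {n..<n + m}"
      using that by auto
    then have "card {i. i < n \<and> P (i + j)} \<le> card ({i. i < n \<and> P i} \<union> {n..<n + m})"
      by (intro card_inj_on_le) auto
    also have "\<dots> \<le> card {i. i < n \<and> P i} + m"
      by (rule card_Un_le[THEN order_trans]) simp
    finally show ?thesis .
  qed
  then have "(\<Sum>j<m. card {i. i < n \<and> P (i + j)}) \<le> m * (card {i. i < n \<and> P i} + m)"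
    using sum_bounded_above[of "{..<m}" "\<lambda>j. card {i. i < n \<and> P (i + j)}"
        "card {i. i < n \<and> P i} + m"] by simp
  moreover have "{i. i < n \<and> (\<exists>j<m. P (i + j))} = (\<Union>j<m. {i. i < n \<and> P (i + j)})"
    by auto
  ultimately show ?thesis
    using card_UN_le[of "{..<m}" "\<lambda>j. {i. i < n \<and> P (i + j)}"] by simp
qed

text \<open>Every counted \<open>i\<close> is \<open>t + j\<close> with \<open>P t\<close> and
  \<open>j\<close> in \<open>{1..M}\<close>. The window looks back, so \<open>t < n\<close> and no
  boundary term appears.\<close>

lemma card_trailing_window_le:
  "card {i. i < n \<and> (\<exists>t<i. i \<le> t + M \<and> P t)} \<le> M * card {t. t < n \<and> P t}" for n M :: nat
proof -
  have "{i. i < n \<and> (\<exists>t<i. i \<le> t + M \<and> P t)} \<subseteq> (\<lambda>(j, t). t + j) ` ({1..M} \<times> {t. t < n \<and> P t})"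
  proof (clarify)
    fix i t assume "i < n" "t < i" "i \<le> t + M" "P t"
    then show "i \<in> (\<lambda>(j, t). t + j) ` ({1..M} \<times> {t. t < n \<and> P t})"
      by (intro image_eqI[of _ _ "(i - t, t)"]) auto
  qed
  then have "card {i. i < n \<and> (\<exists>t<i. i \<le> t + M \<and> P t)} \<le> card ({1..M} \<times> {t. t < n \<and> P t})"
    by (rule surj_card_le[rotated]) simp
  then show ?thesis by (simp add: card_cartesian_product)
qed

text \<open>Going back one time step moves the letter read one place to the right. Time plus place
  stays constant, so \<open>j + l \<le> M\<close> keeps every place within the range where a step
  without a jump preserves letters.\<close>

lemma trace_without_jumps:
  assumes "\<And>t. t < j \<Longrightarrow> rho (shift (xs (i + t))) (xs (Suc (i + t))) < (1/2) ^ M"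
    and "j + l \<le> M"
  shows "xs (i + j) l = xs i (j + l)"
  using assms
proof (induction j arbitrary: l)
  case (Suc j)
  have "shift (xs (i + j)) l = xs (Suc (i + j)) l"
  proof (rule ccontr)
    assume "shift (xs (i + j)) l \<noteq> xs (Suc (i + j)) l"
    then have "(1/2) ^ M \<le> rho (shift (xs (i + j))) (xs (Suc (i + j)))"
      by (rule rho_ge_power) (use Suc.prems in simp)
    with Suc.prems(1)[of j] show False by simp
  qed
  moreover have "xs (i + j) (Suc l) = xs i (j + Suc l)"
    by (rule Suc.IH) (use Suc.prems in auto)
  ultimately show ?case by (simp add: shift_def)
qed simp

lemma dbar_shadowing_imp_average_shadowing:
  assumes "dbar_shadowing X"
  shows "average_shadowing X"
  unfolding average_shadowing_def
proof (intro allI impI)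
  fix \<epsilon> :: real assume "\<epsilon> > 0"
  obtain m0 where "(1/2::real) ^ m0 < \<epsilon> / 4"
    using real_arch_pow_inv[of "\<epsilon> / 4" "1/2"] \<open>\<epsilon> > 0\<close> by auto
  \<comment> \<open>Passing to \<open>Suc m0\<close> secures \<open>m > 0\<close>, without which
    \<open>\<epsilon> / (4 * m)\<close> would be 0.\<close>
  moreover have "(1/2::real) ^ Suc m0 \<le> (1/2) ^ m0"
    by (rule power_decreasing) auto
  ultimately obtain m where m: "(1/2::real) ^ m < \<epsilon> / 4" "m > 0"
    by (meson le_less_trans zero_less_Suc)
  \<comment> \<open>A wrong letter spoils up to \<open>m\<close> windows of length \<open>m\<close>,
    so its density is charged \<open>m\<close> times.\<close>
  then have "\<epsilon> / (4 * m) > 0" using \<open>\<epsilon> > 0\<close> by simp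
  with assms obtain N where N: "\<And>w. \<forall>i. w i \<in> language X \<and> length (w i) \<ge> N \<Longrightarrow>
        \<exists>x\<in>X. dbar x (inf_concat w) < ereal (\<epsilon> / (4 * m))"
    unfolding dbar_shadowing_def by meson
  \<comment> \<open>Blocks must be long enough for shadowing, and the absence of jumps must control
    \<open>m\<close> letters.\<close>
  define M where "M = max N m"
  have M: "N \<le> M" "m \<le> M" "0 < M" using m by (auto simp: M_def)
  \<comment> \<open>\<open>m * (1 + M)\<close> is the charge per jump in \<open>sum_le\<close>;
    \<open>2 ^ M\<close> is the factor from Markov's inequality in \<open>B_le\<close>.\<close>
  define C :: real where "C = real m * (1 + real M) * 2 ^ M"
  have "C > 0" unfolding C_def using m by (intro mult_pos_pos) auto
  define \<delta> where "\<delta> = \<epsilon> / (4 * C)"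
  have "\<delta> > 0" using \<open>\<epsilon> > 0\<close> \<open>C > 0\<close> by (simp add: \<delta>_def)
  have "\<exists>z\<in>X. limsup (\<lambda>n. ereal (1 / real n * (\<Sum>i<n. rho ((shift ^^ i) z) (xs i)))) < ereal \<epsilon>"
    if xs: "average_pseudo_orbit X \<delta> xs" for xs
  proof -
    define jump where "jump t \<longleftrightarrow> (1/2) ^ M \<le> rho (shift (xs t)) (xs (Suc t))" for t
    define w where "w k = map (xs (k * M)) [0..<M]" for k
    have "w k \<in> language X \<and> length (w k) \<ge> N" for k
      using xs M by (auto simp: language_def w_def average_pseudo_orbit_def)
    then obtain z where "z \<in> X" and z: "dbar z (inf_concat w) < ereal (\<epsilon> / (4 * m))"
      using N by blast
    have w_nth: "inf_concat w i = xs (i div M * M) (i mod M)" for i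
    proof -
      have "inf_concat w ((\<Sum>k<i div M. length (w k)) + i mod M) = w (i div M) ! (i mod M)"
        using M by (intro inf_concat_nth) (auto simp: w_def)
      then show ?thesis using M by (simp add: w_def)
    qed
    define B where "B n = card {t. t < n \<and> jump t}" for n
    define D where "D n = card {i. i < n \<and> z i \<noteq> inf_concat w i}" for n
    have D': "card {i. i < n \<and> z i \<noteq> xs i 0} \<le> D n + M * B n" for n
    proof -
      \<comment> \<open>A mismatch at \<open>i\<close> forces a jump between the start of the block
        of \<open>i\<close> and \<open>i\<close>, hence within the last \<open>M\<close>
        times.\<close>
      have "\<exists>t<i. i \<le> t + M \<and> jump t" if "inf_concat w i \<noteq> xs i 0" for i
      proof (rule ccontr)
        assume none: "\<not> (\<exists>t<i. i \<le> t + M \<and> jump t)"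
        have "xs (i div M * M + i mod M) 0 = xs (i div M * M) (i mod M + 0)"
        proof (rule trace_without_jumps)
          fix t assume t: "t < i mod M"
          have "i = i div M * M + i mod M" "i mod M < M" using M by auto
          then have "i div M * M + t < i" "i \<le> i div M * M + t + M"
            using t by linarith+
          with none have "\<not> jump (i div M * M + t)" by blast
          then show "rho (shift (xs (i div M * M + t))) (xs (Suc (i div M * M + t))) < (1/2) ^ M"
            by (simp add: jump_def)
        qed (use M in \<open>simp add: less_imp_le\<close>)
        then show False using that by (simp add: w_nth)
      qed
      then have "{i. i < n \<and> z i \<noteq> xs i 0} \<subseteq> {i. i < n \<and> z i \<noteq> inf_concat w i} \<union>
          {i. i < n \<and> (\<exists>t<i. i \<le> t + M \<and> jump t)}"
        by auto
      then have "card {i. i < n \<and> z i \<noteq> xs i 0} \<le> card ({i. i < n \<and> z i \<noteq> inf_concat w i} \<union>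
          {i. i < n \<and> (\<exists>t<i. i \<le> t + M \<and> jump t)})"
        by (intro card_mono) auto
      also have "\<dots> \<le> D n + M * B n"
        unfolding D_def B_def
        by (rule card_Un_le[THEN order_trans]) (intro add_left_mono card_trailing_window_le)
      finally show ?thesis .
    qed
    \<comment> \<open>With no jump and no wrong letter in the window of length \<open>m\<close> from
      \<open>i\<close>, both points share \<open>m\<close> letters; otherwise the trivial bound 1
      applies.\<close>
    have rho_le: "rho ((shift ^^ i) z) (xs i) \<le>
        (1/2) ^ m + of_bool (\<exists>j<m. jump (i + j)) + of_bool (\<exists>j<m. z (i + j) \<noteq> xs (i + j) 0)" for i
    proof (cases "(\<exists>j<m. jump (i + j)) \<or> (\<exists>j<m. z (i + j) \<noteq> xs (i + j) 0)")
      case True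
      then show ?thesis
        using rho_le_1[of "(shift ^^ i) z" "xs i"] by (auto intro: order_trans)
    next
      case False
      have "(shift ^^ i) z j = xs i j" if "j < m" for j
      proof -
        have "xs (i + j) 0 = xs i (j + 0)"
          using False that M by (intro trace_without_jumps[where M = M]) (auto simp: jump_def not_le)
        with False that show ?thesis by (auto simp: shift_funpow)
      qed
      then have "rho ((shift ^^ i) z) (xs i) \<le> (1/2) ^ m" by (rule rho_le_power)
      with False show ?thesis by simp
    qed
    \<comment> \<open>Jumps enter twice: directly, and \<open>M\<close>-fold through the wrong
      letters of \<open>D'\<close>. The two window counts give the boundary terms
      \<open>2 * m^2\<close>.\<close>
    have sum_le: "(\<Sum>i<n. rho ((shift ^^ i) z) (xs i)) \<le>
        real n * (1/2) ^ m + real m * (1 + real M) * real (B n) + 2 * (real m)\<^sup>2 + real m * real (D n)" for n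
    proof -
      have "(\<Sum>i<n. rho ((shift ^^ i) z) (xs i)) \<le> (\<Sum>i<n. (1/2) ^ m +
          of_bool (\<exists>j<m. jump (i + j)) + of_bool (\<exists>j<m. z (i + j) \<noteq> xs (i + j) 0))"
        by (intro sum_mono rho_le)
      also have "\<dots> = n * (1/2) ^ m + real (card {i. i < n \<and> (\<exists>j<m. jump (i + j))}) +
          real (card {i. i < n \<and> (\<exists>j<m. z (i + j) \<noteq> xs (i + j) 0)})"
        by (simp add: sum.distrib lessThan_def Collect_conj_eq)
      also have "\<dots> \<le> n * (1/2) ^ m + real (m * (B n + m)) + real (m * ((D n + M * B n) + m))"
        unfolding B_def
        by (intro add_mono order_refl of_nat_mono card_window_le
            card_window_le[THEN order_trans] mult_left_mono D'[unfolded B_def]) auto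
      finally show ?thesis by (simp add: algebra_simps power2_eq_square)
    qed
    obtain N0 where "N0 \<ge> 1"
      "\<forall>n\<ge>N0. \<forall>k. 1 / real n * (\<Sum>i<n. rho (shift (xs (i + k))) (xs (i + k + 1))) < \<delta>"
      using xs unfolding average_pseudo_orbit_def by blast
    then have N0: "N0 \<ge> 1"
      and "n \<ge> N0 \<Longrightarrow> 1 / real n * (\<Sum>t<n. rho (shift (xs (t + 0))) (xs (t + 0 + 1))) < \<delta>" for n
      by blast+
    then have avg: "1 / real n * (\<Sum>t<n. rho (shift (xs t)) (xs (Suc t))) < \<delta>" if "n \<ge> N0" for n
      using that by simp
    have B_le: "real m * (1 + real M) * real (B n) \<le> real n * (\<epsilon> / 4)" if "n \<ge> N0" for n
    proof -
      have "n > 0" using that N0 by simp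
      \<comment> \<open>Markov's inequality: each jump contributes at least 2^-M to the sum.\<close>
      have "B n * (1/2) ^ M = (\<Sum>t<n. of_bool (jump t) * (1/2) ^ M :: real)"
        by (simp add: B_def lessThan_def Collect_conj_eq flip: sum_distrib_right)
      also have "\<dots> \<le> (\<Sum>t<n. rho (shift (xs t)) (xs (Suc t)))"
        by (intro sum_mono) (auto simp: jump_def rho_nonneg)
      also have "\<dots> \<le> n * \<delta>"
        using avg[OF that] \<open>n > 0\<close> by (simp add: field_simps)
      finally have "B n \<le> 2 ^ M * (n * \<delta>)"
        by (simp add: power_divide field_simps)
      then have "real m * (1 + real M) * real (B n) \<le> real m * (1 + real M) * (2 ^ M * (n * \<delta>))"
        by (intro mult_left_mono) auto
      also have "\<dots> = n * (C * \<delta>)" by (simp add: C_def)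
      also have "C * \<delta> = \<epsilon> / 4" using \<open>C > 0\<close> by (simp add: \<delta>_def)
      finally show ?thesis .
    qed
    obtain N1 :: nat where N1: "16 * (real m)\<^sup>2 / \<epsilon> < N1"
      using reals_Archimedean2 by blast
    have "eventually (\<lambda>n. ereal (1 / real n * real (D n)) < ereal (\<epsilon> / (4 * m))) sequentially"
      using z unfolding dbar_def D_def by (rule Limsup_lessD)
    \<comment> \<open>Three terms of \<epsilon>/4 and a boundary term of \<epsilon>/8 total
      7\<epsilon>/8; the slack keeps the limsup strictly below \<epsilon>.\<close>
    then have "eventually (\<lambda>n. 1 / real n * (\<Sum>i<n. rho ((shift ^^ i) z) (xs i)) \<le> 7 * \<epsilon> / 8)
        sequentially"
      using eventually_ge_at_top[of N0] eventually_ge_at_top[of N1]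
    proof eventually_elim
      case (elim n)
      have "n > 0" using elim N0 by simp
      have "m * real (D n) \<le> n * (\<epsilon> / 4)"
        using elim(1) \<open>n > 0\<close> m by (simp add: field_simps)
      moreover have "2 * (real m)\<^sup>2 \<le> n * (\<epsilon> / 8)"
      proof -
        have "16 * (real m)\<^sup>2 / \<epsilon> \<le> n" using N1 elim(3) by linarith
        then show ?thesis using \<open>\<epsilon> > 0\<close> by (simp add: field_simps)
      qed
      moreover have "n * (1/2) ^ m \<le> n * (\<epsilon> / 4)"
        using m by (intro mult_left_mono) auto
      ultimately have "(\<Sum>i<n. rho ((shift ^^ i) z) (xs i)) \<le> n * (7 * \<epsilon> / 8)"
        using sum_le[of n] B_le[OF elim(2)] by simp
      then show ?case using \<open>n > 0\<close> by (simp add: field_simps)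
    qed
    then have "limsup (\<lambda>n. ereal (1 / real n * (\<Sum>i<n. rho ((shift ^^ i) z) (xs i))))
        \<le> ereal (7 * \<epsilon> / 8)"
      by (intro Limsup_bounded) (simp only: ereal_less_eq)
    also have "\<dots> < ereal \<epsilon>" using \<open>\<epsilon> > 0\<close> by simp
    finally show ?thesis using \<open>z \<in> X\<close> by blast
  qed
  with \<open>\<delta> > 0\<close> show "\<exists>\<delta>>0. \<forall>xs. average_pseudo_orbit X \<delta> xs \<longrightarrow>
      (\<exists>z\<in>X. limsup (\<lambda>n. ereal (1 / real n * (\<Sum>i<n. rho ((shift ^^ i) z) (xs i)))) < ereal \<epsilon>)"
    by blast
qed

theorem theorem4:
  fixes X :: "(nat \<Rightarrow> bool) set"
  assumes "shift_space X"
    and "shift ` X = X"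
  shows "average_shadowing X \<longleftrightarrow> dbar_shadowing X"
  using average_shadowing_imp_dbar_shadowing[OF equalityD1[OF assms(2)]]
    dbar_shadowing_imp_average_shadowing by (rule iffI)

end
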